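(* Let $\mathscr{A}$ be a $C^*$-algebra, $\mathscr{X}$ a Hilbert $\mathscr{A}$-module and $\mathscr{Y}$ a closed submodule of $\mathscr{X}$. Let $B:\mathscr{X}\times\mathscr{X}\to\mathscr{A}$ be a bounded $\mathscr{A}$-sesquilinear form, and let $T:\mathscr{X}\to\mathscr{X}'$ be the bounded $\mathscr{A}$-linear map given by $T(x)(y)=B(x,y)$. Suppose that $\{z\in\mathscr{Y}:B(z,y)=0\text{ for all }y\in\mathscr{Y}\}=\{0\}$. Then the $B$-spline interpolation problem has a solution for $\mathscr{Y}$ if and only if $$\{(Tx)|_{\mathscr{Y}}:x\in\mathscr{X}\}\subseteq\{(Ty)|_{\mathscr{Y}}:y\in\mathscr{Y}\}.$$
   Context: Hilbert $C^*$-modules are right modules with inner product conjugate-linear in the first and $\mathscr{A}$-linear in the second variable. A bounded $\mathscr{A}$-sesquilinear form is a bounded map $B$ that is anti-$\mathscr{A}$-linear in the first and $\mathscr{A}$-linear in the second variable ($B(xa,yb)=a^*B(x,y)b$). $\mathscr{X}'$ is the set of bounded $\mathscr{A}$-linear maps $\mathscr{X}\to\mathscr{A}$, a right $\mathscr{A}$-module via $(\rho+\lambda\tau)(x)=\rho(x)+\overline{\lambda}\tau(x)$, $(\tau b)(x)=b^*\tau(x)$. The $B$-spline interpolation problem has a solution for $\mathscr{Y}$ if for every $x\in\mathscr{X}$ there is $s\in x+\mathscr{Y}$ with $B(s,y)=0$ for all $y\in\mathscr{Y}$. *)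

theory Defs
  imports "HOL-Analysis.Analysis" "HOL-Library.FuncSet"
begin

class complex_vector = real_vector +
  fixes scaleC :: "complex \<Rightarrow> 'a \<Rightarrow> 'a" (infixr "*\<^sub>C" 75)
  assumes scaleC_add_right: "c *\<^sub>C (x + y) = c *\<^sub>C x + c *\<^sub>C y"
    and scaleC_add_left: "(c + d) *\<^sub>C x = c *\<^sub>C x + d *\<^sub>C x"
    and scaleC_scaleC: "c *\<^sub>C d *\<^sub>C x = (c * d) *\<^sub>C x"
    and scaleC_one: "1 *\<^sub>C x = x"
    and scaleR_scaleC: "r *\<^sub>R x = complex_of_real r *\<^sub>C x"

class complex_normed_vector = complex_vector + real_normed_vector +
  assumes norm_scaleC: "norm (c *\<^sub>C x) = cmod c * norm x"

text \<open>No unit is required, and the zero algebra is allowed.\<close>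

class cstar_algebra = complex_normed_vector + real_normed_algebra + banach +
  fixes star :: "'a \<Rightarrow> 'a"
  assumes scaleC_mult_left: "(c *\<^sub>C a) * b = c *\<^sub>C (a * b)"
    and scaleC_mult_right: "a * (c *\<^sub>C b) = c *\<^sub>C (a * b)"
    and star_add: "star (a + b) = star a + star b"
    and star_scaleC: "star (c *\<^sub>C a) = cnj c *\<^sub>C star a"
    and star_mult: "star (a * b) = star b * star a"
    and star_star: "star (star a) = a"
    and cstar_identity: "norm (star a * a) = (norm a)\<^sup>2"

definition cstar_positive :: "'a::cstar_algebra \<Rightarrow> bool"
  where "cstar_positive a \<longleftrightarrow> (\<exists>b. a = star b * b)"

text \<open>The norm and the complete metric of the type of \<open>x\<close> are tied to the inner product by
  \<open>norm_eq\<close>.\<close>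

locale hilbert_cstar_module =
  fixes act :: "'x::{complex_normed_vector, banach} \<Rightarrow> 'a::cstar_algebra \<Rightarrow> 'x"
    and ip :: "'x \<Rightarrow> 'x \<Rightarrow> 'a"
  assumes act_add_left: "act (x + y) a = act x a + act y a"
    and act_add_right: "act x (a + b) = act x a + act x b"
    and act_mult: "act x (a * b) = act (act x a) b"
    and act_scaleC_left: "act (c *\<^sub>C x) a = c *\<^sub>C act x a"
    and act_scaleC_right: "act x (c *\<^sub>C a) = c *\<^sub>C act x a"
    and ip_add_right: "ip x (y + z) = ip x y + ip x z"
    and ip_scaleC_right: "ip x (c *\<^sub>C y) = c *\<^sub>C ip x y"
    and ip_act_right: "ip x (act y a) = ip x y * a"
    and star_ip: "star (ip x y) = ip y x"
    and ip_positive: "cstar_positive (ip x x)"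
    and ip_definite: "ip x x = 0 \<Longrightarrow> x = 0"
    and norm_eq: "norm x = sqrt (norm (ip x x))"

definition closed_submodule ::
  "('x::complex_normed_vector \<Rightarrow> 'a::cstar_algebra \<Rightarrow> 'x) \<Rightarrow> 'x set \<Rightarrow> bool"
  where "closed_submodule act Y \<longleftrightarrow> closed Y \<and> 0 \<in> Y \<and> (\<forall>x\<in>Y. \<forall>y\<in>Y. x + y \<in> Y) \<and>
    (\<forall>c. \<forall>x\<in>Y. c *\<^sub>C x \<in> Y) \<and> (\<forall>a. \<forall>x\<in>Y. act x a \<in> Y)"

definition bounded_sesquilinear_form ::
  "('x::complex_normed_vector \<Rightarrow> 'a::cstar_algebra \<Rightarrow> 'x) \<Rightarrow> ('x \<Rightarrow> 'x \<Rightarrow> 'a) \<Rightarrow> bool"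
  where "bounded_sesquilinear_form act B \<longleftrightarrow>
    (\<forall>x y z. B (x + y) z = B x z + B y z) \<and>
    (\<forall>c x y. B (c *\<^sub>C x) y = cnj c *\<^sub>C B x y) \<and>
    (\<forall>a x y. B (act x a) y = star a * B x y) \<and>
    (\<forall>x y z. B x (y + z) = B x y + B x z) \<and>
    (\<forall>c x y. B x (c *\<^sub>C y) = c *\<^sub>C B x y) \<and>
    (\<forall>a x y. B x (act y a) = B x y * a) \<and>
    (\<exists>K. \<forall>x y. norm (B x y) \<le> K * norm x * norm y)"

text \<open>\<open>dual_module act\<close> is \<open>X'\<close>, normed by \<^const>\<open>onorm\<close>. Its scalar multiplication and module
  action are conjugated so that \<open>x \<mapsto> B x\<close> is linear although \<open>B\<close> is
  conjugate-linear in its first argument.\<close>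

definition dual_module ::
  "('x::complex_normed_vector \<Rightarrow> 'a::cstar_algebra \<Rightarrow> 'x) \<Rightarrow> ('x \<Rightarrow> 'a) set"
  where "dual_module act = {f. (\<forall>x y. f (x + y) = f x + f y) \<and> (\<forall>c x. f (c *\<^sub>C x) = c *\<^sub>C f x) \<and>
    (\<forall>a x. f (act x a) = f x * a) \<and> (\<exists>K. \<forall>x. norm (f x) \<le> K * norm x)}"

definition dual_add :: "('x \<Rightarrow> 'a::cstar_algebra) \<Rightarrow> ('x \<Rightarrow> 'a) \<Rightarrow> 'x \<Rightarrow> 'a"
  where "dual_add \<rho> \<tau> = (\<lambda>x. \<rho> x + \<tau> x)"

definition dual_scaleC :: "complex \<Rightarrow> ('x \<Rightarrow> 'a::cstar_algebra) \<Rightarrow> 'x \<Rightarrow> 'a"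
  where "dual_scaleC c \<tau> = (\<lambda>x. cnj c *\<^sub>C \<tau> x)"

definition dual_act :: "('x \<Rightarrow> 'a::cstar_algebra) \<Rightarrow> 'a \<Rightarrow> 'x \<Rightarrow> 'a"
  where "dual_act \<tau> b = (\<lambda>x. star b * \<tau> x)"

definition bounded_linear_to_dual ::
  "('x::complex_normed_vector \<Rightarrow> 'a::cstar_algebra \<Rightarrow> 'x) \<Rightarrow> ('x \<Rightarrow> 'x \<Rightarrow> 'a) \<Rightarrow> bool"
  where "bounded_linear_to_dual act T \<longleftrightarrow>
    (\<forall>x. T x \<in> dual_module act) \<and>
    (\<forall>x y. T (x + y) = dual_add (T x) (T y)) \<and>
    (\<forall>c x. T (c *\<^sub>C x) = dual_scaleC c (T x)) \<and>
    (\<forall>a x. T (act x a) = dual_act (T x) a) \<and>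
    (\<exists>K. \<forall>x. onorm (T x) \<le> K * norm x)"

text \<open>The map \<open>T\<close> induced by a bounded form is automatically a bounded module map into the
  dual, so the identity \<open>T x y = B x y\<close> is all that has to be assumed of it.\<close>

lemma bounded_linear_to_dual_induced:
  assumes B: "bounded_sesquilinear_form act B" and T: "\<And>x y. T x y = B x y"
  shows "bounded_linear_to_dual act T"
proof -
  have TB: "T = B" using T by (intro ext)
  obtain K where K: "\<And>x y. norm (B x y) \<le> K * norm x * norm y"
    using B unfolding bounded_sesquilinear_form_def by (elim conjE exE) auto
  have K': "norm (B x y) \<le> (\<bar>K\<bar> * norm x) * norm y" for x y
    using K[of x y] by (smt (verit) mult_right_mono norm_ge_zero)
  have "onorm (B x) \<le> \<bar>K\<bar> * norm x" for x
    by (rule onorm_bound) (use K' in auto)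
  moreover have "B x \<in> dual_module act" for x
    using B K' unfolding dual_module_def bounded_sesquilinear_form_def by auto
  ultimately show ?thesis
    using B unfolding TB bounded_linear_to_dual_def bounded_sesquilinear_form_def
      dual_add_def dual_scaleC_def dual_act_def by auto
qed

definition spline_problem_solvable :: "('x::ab_group_add \<Rightarrow> 'x \<Rightarrow> 'a::zero) \<Rightarrow> 'x set \<Rightarrow> bool"
  where "spline_problem_solvable B Y \<longleftrightarrow>
    (\<forall>x. \<exists>s \<in> {x + y | y. y \<in> Y}. \<forall>y\<in>Y. B s y = 0)"

end

theory Submission
  imports Defs
begin

text \<open>Since \<open>Y\<close> is closed under negation, the candidates for a spline at
  \<open>x\<close> are the differences \<open>x - u\<close> with \<open>u\<close> in
  \<open>Y\<close> (\<open>spline_problem_solvable_iff_diff\<close>). Since \<open>B\<close>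
  respects differences in its first argument (\<open>bounded_sesquilinear_form_diff_left\<close>),
  \<open>x - u\<close> is a spline exactly when the functionals \<open>T x\<close> and
  \<open>T u\<close> agree on \<open>Y\<close>. So the problem is solvable at \<open>x\<close> iff
  the restriction of \<open>T x\<close> to \<open>Y\<close> is also the restriction of some
  \<open>T u\<close> with \<open>u\<close> in \<open>Y\<close>; letting \<open>x\<close> vary gives
  the inclusion.\<close>

lemma closed_submodule_uminus:
  assumes "closed_submodule act Y" and "y \<in> Y"
  shows "- y \<in> Y"
proof -
  \<comment> \<open>The scalar is written as an embedded real so that \<open>scaleR_scaleC\<close>
    can turn the product into a real multiple, which simplifies to \<open>- y\<close>.\<close>
  have "complex_of_real (- 1) *\<^sub>C y \<in> Y"
    using assms unfolding closed_submodule_def by blast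
  then show ?thesis
    unfolding scaleR_scaleC[symmetric] by simp
qed

lemma bounded_sesquilinear_form_add_left:
  assumes "bounded_sesquilinear_form act B"
  shows "B (x + y) z = B x z + B y z"
  using assms unfolding bounded_sesquilinear_form_def by blast

lemma bounded_sesquilinear_form_diff_left:
  assumes "bounded_sesquilinear_form act B"
  shows "B (x - y) z = B x z - B y z"
proof -
  interpret additive "\<lambda>x. B x z"
    by unfold_locales (rule bounded_sesquilinear_form_add_left[OF assms])
  show ?thesis by (rule diff)
qed

text \<open>Substituting \<open>u = - v\<close> in \<open>x + v\<close> puts the spline condition
  into the form in which it compares the functionals of \<open>x\<close> and
  \<open>u\<close>.\<close>

lemma spline_problem_solvable_iff_diff:
  assumes "closed_submodule act Y"
  shows "spline_problem_solvable B Y \<longleftrightarrow> (\<forall>x. \<exists>u\<in>Y. \<forall>y\<in>Y. B (x - u) y = 0)"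
proof -
  have "(\<exists>s\<in>{x + y | y. y \<in> Y}. \<forall>y\<in>Y. B s y = 0) \<longleftrightarrow> (\<exists>u\<in>Y. \<forall>y\<in>Y. B (x - u) y = 0)" for x
  proof
    assume "\<exists>s\<in>{x + y | y. y \<in> Y}. \<forall>y\<in>Y. B s y = 0"
    \<comment> \<open>The double negation displays \<open>- v\<close> as the witness for
      \<open>u\<close>.\<close>
    then obtain v where "v \<in> Y" "\<forall>y\<in>Y. B (x - (- v)) y = 0" by auto
    then show "\<exists>u\<in>Y. \<forall>y\<in>Y. B (x - u) y = 0"
      using closed_submodule_uminus[OF assms] by blast
  next
    assume "\<exists>u\<in>Y. \<forall>y\<in>Y. B (x - u) y = 0"
    then obtain u where u: "u \<in> Y" "\<forall>y\<in>Y. B (x + (- u)) y = 0" by auto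
    then show "\<exists>s\<in>{x + y | y. y \<in> Y}. \<forall>y\<in>Y. B s y = 0"
      using closed_submodule_uminus[OF assms] by blast
  qed
  then show ?thesis unfolding spline_problem_solvable_def by blast
qed

theorem theorem3p8:
  fixes act :: "'x::{complex_normed_vector, banach} \<Rightarrow> 'a::cstar_algebra \<Rightarrow> 'x"
    and ip :: "'x \<Rightarrow> 'x \<Rightarrow> 'a"
    and Y :: "'x set"
    and B :: "'x \<Rightarrow> 'x \<Rightarrow> 'a"
    and T :: "'x \<Rightarrow> ('x \<Rightarrow> 'a)"
  assumes "hilbert_cstar_module act ip"
    and "closed_submodule act Y"
    and "bounded_sesquilinear_form act B"
    and "\<And>x y. T x y = B x y"
    and "{z \<in> Y. \<forall>y\<in>Y. B z y = 0} = {0}"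
  shows "spline_problem_solvable B Y \<longleftrightarrow>
    {restrict (T x) Y | x. True} \<subseteq> {restrict (T y) Y | y. y \<in> Y}"
proof -
  have TB: "T = B" using assms(4) by (intro ext)
  \<comment> \<open>Outside \<open>Y\<close> both restrictions take the value
    \<open>undefined\<close>, so their equality only compares values on \<open>Y\<close>.\<close>
  have eq: "restrict (B x) Y = restrict (B u) Y \<longleftrightarrow> (\<forall>y\<in>Y. B (x - u) y = 0)" for x u
    by (auto simp: restrict_def fun_eq_iff bounded_sesquilinear_form_diff_left[OF assms(3)])
  have "{restrict (T x) Y | x. True} \<subseteq> {restrict (T y) Y | y. y \<in> Y} \<longleftrightarrow>
      (\<forall>x. \<exists>u\<in>Y. restrict (B x) Y = restrict (B u) Y)"
    unfolding TB by blast
  then show ?thesis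
    unfolding eq spline_problem_solvable_iff_diff[OF assms(2)] by simp
qed

end
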